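(* For all positive integers $n$ and $d$, there exists a family of $n\cdot d+1$ mass distributions in $\mathbb{R}^d$ that cannot be simultaneously bisected by any set of $n$ hyperplanes.
   Context: A mass distribution $\mu$ on $\mathbb{R}^d$ is a measure such that all open subsets are measurable, $0<\mu(\mathbb{R}^d)<\infty$, and $\mu(S)=0$ for every lower-dimensional subset $S$. For a finite set $\mathcal{L}$ of oriented hyperplanes, each $\ell\in\mathcal{L}$ has positive side $\ell^+=\{x:g(x)\ge 0\}$ for a defining affine function $g(x)=a_1x_1+\dots+a_dx_d+a_0$; hyperplanes at infinity ($g\equiv a_0\neq0$) are allowed, with $\ell^+=\mathbb{R}^d$, $\ell^-=\emptyset$. Let $\lambda(p)$ be the number of hyperplanes having $p$ on their positive side, $R^+=\{p:\lambda(p)\text{ even}\}$, $R^-=\{p:\lambda(p)\text{ odd}\}$. $\mathcal{L}$ simultaneously bisects $\mu_1,\dots,\mu_k$ if $\mu_i(R^+)=\mu_i(R^-)$ for all $i$; an unoriented set bisects if some orientation does. *)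

theory Defs
  imports "HOL-Analysis.Analysis"
begin

definition mass_distribution :: "'a::euclidean_space measure \<Rightarrow> bool" where
  "mass_distribution \<mu> \<longleftrightarrow>
     space \<mu> = UNIV \<and>
     (\<forall>U. open U \<longrightarrow> U \<in> sets \<mu>) \<and>
     0 < emeasure \<mu> UNIV \<and> emeasure \<mu> UNIV < \<infinity> \<and>
     (\<forall>S \<in> sets \<mu>. aff_dim S < int DIM('a) \<longrightarrow> emeasure \<mu> S = 0)"

text \<open>An oriented hyperplane is given by its defining affine function
  g(x) = a \<bullet> x + a0, encoded as the pair (a, a0) with (a, a0) \<noteq> (0, 0).
  If a = 0 it is a hyperplane at infinity.\<close>
definition oriented_hyperplane :: "'a::euclidean_space \<times> real \<Rightarrow> bool" where
  "oriented_hyperplane h \<longleftrightarrow> h \<noteq> (0, 0)"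

definition pos_side :: "'a::euclidean_space \<times> real \<Rightarrow> 'a set" where
  "pos_side h = {x. fst h \<bullet> x + snd h \<ge> 0}"

definition pos_count :: "('a::euclidean_space \<times> real) list \<Rightarrow> 'a \<Rightarrow> nat" where
  "pos_count L p = length (filter (\<lambda>h. p \<in> pos_side h) L)"

definition R_plus :: "('a::euclidean_space \<times> real) list \<Rightarrow> 'a set" where
  "R_plus L = {p. even (pos_count L p)}"

definition R_minus :: "('a::euclidean_space \<times> real) list \<Rightarrow> 'a set" where
  "R_minus L = {p. odd (pos_count L p)}"

definition simul_bisects ::
  "('a::euclidean_space \<times> real) list \<Rightarrow> (nat \<Rightarrow> 'a measure) \<Rightarrow> nat set \<Rightarrow> bool" where
  "simul_bisects L \<mu> I \<longleftrightarrow>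
     (\<forall>i\<in>I. emeasure (\<mu> i) (R_plus L) = emeasure (\<mu> i) (R_minus L))"

end

theory Submission
  imports Defs
begin

text \<open>Take uniform masses on small balls around n d + 1 points in general position. A family
  of hyperplanes that bisects a ball mass must cut the ball, since otherwise the parity of the
  positive-side count is constant on it. The balls are so small that no hyperplane comes close
  to d + 1 of the centres, as these are affinely independent; so n hyperplanes cut at most n d
  balls, one short of n d + 1.\<close>

lemma negligible_if_aff_dim_less:
  fixes S :: "'a::euclidean_space set"
  assumes "aff_dim S < DIM('a)"
  shows "negligible S"
proof -
  obtain a b where "a \<noteq> 0" "S \<subseteq> {x. a \<bullet> x = b}"
    using aff_lowdim_subset_hyperplane[OF assms] by blast
  then show ?thesis
    using negligible_hyperplane negligible_subset by blast
qed

lemma emeasure_lborel_ball_pos: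
  fixes c :: "'a::euclidean_space"
  assumes "r > 0"
  shows "0 < emeasure lborel (ball c r)"
  using content_ball_pos[OF assms, of c] emeasure_lborel_ball_finite[of c r]
  by (metis Sigma_Algebra.measure_def enn2real_positive_iff)

lemma mass_distribution_ball:
  fixes c :: "'a::euclidean_space"
  assumes "r > 0"
  shows "mass_distribution (density lborel (indicator (ball c r)))"
  unfolding mass_distribution_def
proof (intro conjI ballI allI impI)
  show "0 < emeasure (density lborel (indicator (ball c r))) UNIV"
    using emeasure_lborel_ball_pos[OF assms, of c] by (simp add: emeasure_restricted)
  show "emeasure (density lborel (indicator (ball c r))) UNIV < \<infinity>"
    using emeasure_lborel_ball_finite[of c r] by (simp add: emeasure_restricted)
next
  fix S assume S: "S \<in> sets (density lborel (indicator (ball c r)))"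
    and "aff_dim S < int DIM('a)"
  then have "S \<in> null_sets lborel"
    using negligible_if_aff_dim_less negligible_iff_null_sets null_sets_completion_iff
    by (metis sets_density)
  then have "ball c r \<inter> S \<in> null_sets lborel"
    by (rule null_sets_subset) (use S in auto)
  then have "emeasure lborel (ball c r \<inter> S) = 0"
    by blast
  then show "emeasure (density lborel (indicator (ball c r))) S = 0"
    using S by (simp add: emeasure_restricted)
qed (auto intro: borel_open)

lemma sets_pos_count: "{p. P (pos_count L p)} \<in> sets borel"
proof (induction L arbitrary: P)
  case Nil
  then show ?case by (cases "P 0") (auto simp: pos_count_def)
next
  case (Cons h L)
  have closed: "closed (pos_side h)"
    unfolding pos_side_def by (intro closed_Collect_le continuous_intros)
  have "{p. P (pos_count (h # L) p)} =
      (pos_side h \<inter> {p. P (Suc (pos_count L p))}) \<union> (- pos_side h \<inter> {p. P (pos_count L p)})"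
    by (auto simp: pos_count_def)
  then show ?case
    using Cons.IH[of "\<lambda>k. P (Suc k)"] Cons.IH[of P] closed
    by (auto intro!: borel_closed borel_open)
qed

lemma bisected_ball_is_cut:
  fixes c :: "'a::euclidean_space"
  assumes "r > 0"
    and bisected: "emeasure (density lborel (indicator (ball c r))) (R_plus L) =
                   emeasure (density lborel (indicator (ball c r))) (R_minus L)"
  shows "\<exists>h\<in>set L. \<exists>x\<in>ball c r. \<exists>y\<in>ball c r. x \<in> pos_side h \<and> y \<notin> pos_side h"
proof (rule ccontr)
  assume "\<not> ?thesis"
  then have "pos_count L x = pos_count L c" if "x \<in> ball c r" for x
    unfolding pos_count_def using that \<open>r > 0\<close>
    by (intro arg_cong[where f=length] filter_cong) auto
  then have "ball c r \<subseteq> R_plus L \<and> ball c r \<inter> R_minus L = {} \<or>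
             ball c r \<subseteq> R_minus L \<and> ball c r \<inter> R_plus L = {}"
    unfolding R_plus_def R_minus_def by auto
  moreover have "R_plus L \<in> sets borel" "R_minus L \<in> sets borel"
    unfolding R_plus_def R_minus_def by (rule sets_pos_count)+
  ultimately show False
    using bisected emeasure_lborel_ball_pos[OF \<open>r > 0\<close>, of c]
    by (auto simp: emeasure_restricted Int_absorb2)
qed

lemma hyperplane_cutting_ball_near_center:
  fixes c :: "'a::euclidean_space"
  assumes "x \<in> ball c r" "y \<in> ball c r" "x \<in> pos_side h" "y \<notin> pos_side h"
  shows "\<bar>fst h \<bullet> c + snd h\<bar> < r * norm (fst h)"
proof -
  obtain a b where h: "h = (a, b)" by (cases h)
  have x: "a \<bullet> x + b \<ge> 0" and y: "a \<bullet> y + b < 0"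
    using assms unfolding pos_side_def h by auto
  then have "a \<noteq> 0" by auto
  have "a \<bullet> z - a \<bullet> c < r * norm a" "a \<bullet> c - a \<bullet> z < r * norm a" if "z \<in> ball c r" for z
  proof -
    have "\<bar>a \<bullet> (z - c)\<bar> \<le> norm a * norm (z - c)" by (rule Cauchy_Schwarz_ineq2)
    also have "\<dots> < norm a * r"
      using that \<open>a \<noteq> 0\<close> by (simp add: dist_norm norm_minus_commute)
    finally show "a \<bullet> z - a \<bullet> c < r * norm a" "a \<bullet> c - a \<bullet> z < r * norm a"
      by (auto simp: inner_diff_right mult.commute)
  qed
  then show ?thesis
    using x y assms(1,2) h by (fastforce simp: abs_less_iff)
qed

definition general_position :: "('i \<Rightarrow> 'a::euclidean_space) \<Rightarrow> 'i set \<Rightarrow> bool" where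
  "general_position c I \<longleftrightarrow> inj_on c I \<and>
     (\<forall>T \<subseteq> I. card T \<le> DIM('a) + 1 \<longrightarrow> \<not> affine_dependent (c ` T))"

lemma general_position_exists:
  assumes "finite I"
  shows "\<exists>c :: 'i \<Rightarrow> 'a::euclidean_space. general_position c I"
  using assms
proof (induction I rule: finite_induct)
  case empty
  then show ?case by (simp add: general_position_def)
next
  case (insert k I)
  then obtain c :: "'i \<Rightarrow> 'a" where c: "general_position c I" by blast
  define Ts where "Ts = {T. T \<subseteq> I \<and> card T \<le> DIM('a)}"
  have "negligible (affine hull (c ` T))" if "T \<in> Ts" for T
  proof (rule negligible_if_aff_dim_less)
    have "finite T" using that insert.hyps(1) finite_subset unfolding Ts_def by blast
    then have "aff_dim (c ` T) \<le> int (card T) - 1"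
      using aff_dim_le_card[of "c ` T"] card_image_le[of T c] by simp
    then show "aff_dim (affine hull (c ` T)) < int DIM('a)"
      using that unfolding Ts_def by simp
  qed
  moreover have "finite Ts" unfolding Ts_def using insert.hyps(1) by simp
  ultimately have "negligible (\<Union>T\<in>Ts. affine hull (c ` T))"
    by (intro negligible_Union) auto
  then have "(\<Union>T\<in>Ts. affine hull (c ` T)) \<noteq> UNIV"
    using non_negligible_UNIV by metis
  then obtain q where q: "q \<notin> affine hull (c ` T)" if "T \<in> Ts" for T
    by blast
  have q_new: "q \<noteq> c i" if "i \<in> I" for i
    using q[of "{i}"] that DIM_positive[where 'a='a] hull_inc[of "c i"]
    unfolding Ts_def by fastforce
  have "general_position (c(k := q)) (insert k I)"
    unfolding general_position_def
  proof (intro conjI allI impI)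
    show "inj_on (c(k := q)) (insert k I)"
      using c q_new insert.hyps(2) unfolding general_position_def inj_on_def by auto
  next
    fix T assume T: "T \<subseteq> insert k I" "card T \<le> DIM('a) + 1"
    show "\<not> affine_dependent ((c(k := q)) ` T)"
    proof (cases "k \<in> T")
      case False
      then show ?thesis
        using c T insert.hyps(2) unfolding general_position_def
        by (metis fun_upd_image subset_insert)
    next
      case True
      have "finite T" using T insert.hyps(1) finite_subset by blast
      then have T': "T - {k} \<in> Ts"
        using T True insert.hyps(2) unfolding Ts_def by auto
      have "(c(k := q)) ` T = insert q (c ` (T - {k}))"
        using True insert.hyps(2) T by (auto simp: image_iff)
      moreover have "\<not> affine_dependent (c ` (T - {k}))"
        using c T' unfolding general_position_def Ts_def by simp
      ultimately show ?thesis
        using q[OF T'] by (simp add: affine_independent_insert)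
    qed
  qed
  then show ?case by blast
qed

lemma general_position_affine_hull:
  fixes c :: "'i \<Rightarrow> 'a::euclidean_space"
  assumes "general_position c I" "T \<subseteq> I" "card T = DIM('a) + 1"
  shows "affine hull (c ` T) = UNIV"
proof -
  have "card (c ` T) = DIM('a) + 1"
    using assms inj_on_subset card_image unfolding general_position_def by metis
  moreover have "\<not> affine_dependent (c ` T)"
    using assms unfolding general_position_def by simp
  ultimately have "aff_dim (c ` T) = int DIM('a)"
    using aff_dim_affine_independent[of "c ` T"] by simp
  then show ?thesis using aff_dim_eq_full by blast
qed

lemma affine_hull_UNIV_far_from_hyperplanes:
  fixes c :: "'i \<Rightarrow> 'a::euclidean_space"
  assumes "finite T" and full: "affine hull (c ` T) = UNIV"
  obtains e where "e > 0" "\<And>a b. e * norm a \<le> (\<Sum>i\<in>T. \<bar>a \<bullet> c i + b\<bar>)"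
proof -
  define f where "f = (\<lambda>(a, b). \<Sum>i\<in>T. \<bar>a \<bullet> c i + b\<bar>)"
  define B where "B = (\<Sum>i\<in>T. norm (c i)) + 1"
  define K :: "('a \<times> real) set" where "K = sphere 0 1 \<times> cball 0 B"
  have "T \<noteq> {}" using full by auto
  then obtain i0 where "i0 \<in> T" by blast
  have "B > 0" unfolding B_def using sum_nonneg[of T "\<lambda>i. norm (c i)"] by simp
  then have "compact K" "K \<noteq> {}"
    unfolding K_def by (auto intro: compact_Times)
  moreover have "continuous_on K f"
    unfolding f_def case_prod_unfold by (intro continuous_intros)
  ultimately obtain p0 where "p0 \<in> K" and min: "\<And>p. p \<in> K \<Longrightarrow> f p0 \<le> f p"
    using continuous_attains_inf[of K f] by blast
  obtain a0 b0 where p0: "p0 = (a0, b0)" "norm a0 = 1"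
    using \<open>p0 \<in> K\<close> unfolding K_def by auto
  have "f p0 \<noteq> 0"
  proof
    assume "f p0 = 0"
    then have "c ` T \<subseteq> {x. a0 \<bullet> x = - b0}"
      using \<open>finite T\<close> unfolding f_def p0 by (auto simp: sum_nonneg_eq_0_iff algebra_simps)
    then have "affine hull (c ` T) \<subseteq> {x. a0 \<bullet> x = - b0}"
      by (rule hull_minimal) (simp add: affine_hyperplane)
    then have "a0 \<bullet> a0 = - b0" "a0 \<bullet> 0 = - b0"
      unfolding full by blast+
    then show False using p0 by simp
  qed
  then have "f p0 > 0" unfolding f_def p0 by (simp add: sum_nonneg order_less_le)
  have unit: "min (f p0) 1 \<le> (\<Sum>i\<in>T. \<bar>u \<bullet> c i + b\<bar>)" if "norm u = 1" for u b
  proof (cases "\<bar>b\<bar> \<le> B")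
    case True
    then have "(u, b) \<in> K" unfolding K_def using that by auto
    then show ?thesis using min[of "(u, b)"] unfolding f_def by simp
  next
    case False
    have "\<bar>u \<bullet> c i0\<bar> \<le> norm (c i0)"
      using Cauchy_Schwarz_ineq2[of u "c i0"] that by simp
    moreover have "norm (c i0) \<le> (\<Sum>i\<in>T. norm (c i))"
      using \<open>finite T\<close> \<open>i0 \<in> T\<close> by (intro member_le_sum) auto
    ultimately have "1 \<le> \<bar>u \<bullet> c i0 + b\<bar>" using False unfolding B_def by linarith
    also have "\<dots> \<le> (\<Sum>i\<in>T. \<bar>u \<bullet> c i + b\<bar>)"
      using \<open>finite T\<close> \<open>i0 \<in> T\<close> by (intro member_le_sum) auto
    finally show ?thesis by linarith
  qed
  show ?thesis
  proof (rule that)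
    show "min (f p0) 1 > 0" using \<open>f p0 > 0\<close> by simp
  next
    fix a :: 'a and b :: real
    show "min (f p0) 1 * norm a \<le> (\<Sum>i\<in>T. \<bar>a \<bullet> c i + b\<bar>)"
    proof (cases "a = 0")
      case False
      have "(\<Sum>i\<in>T. \<bar>a \<bullet> c i + b\<bar>) =
          norm a * (\<Sum>i\<in>T. \<bar>(a /\<^sub>R norm a) \<bullet> c i + b / norm a\<bar>)"
        using False by (simp add: sum_distrib_left abs_mult[symmetric] field_simps)
      then show ?thesis
        using unit[of "a /\<^sub>R norm a" "b / norm a"] False
        by (simp add: mult.commute mult_left_mono)
    qed (simp add: sum_nonneg)
  qed
qed

lemma general_position_few_points_near_hyperplane:
  fixes c :: "'i \<Rightarrow> 'a::euclidean_space"
  assumes "finite I" "general_position c I"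
  obtains r where "r > 0" "\<And>a b. card {i\<in>I. \<bar>a \<bullet> c i + b\<bar> < r * norm a} \<le> DIM('a)"
proof -
  define Ts where "Ts = {T. T \<subseteq> I \<and> card T = DIM('a) + 1}"
  have "finite Ts" unfolding Ts_def using \<open>finite I\<close> by simp
  have far: "\<forall>T\<in>Ts. \<exists>e>0. \<forall>a b. e * norm a \<le> (\<Sum>i\<in>T. \<bar>a \<bullet> c i + b\<bar>)"
  proof
    fix T assume "T \<in> Ts"
    then have "finite T" "affine hull (c ` T) = UNIV"
      using assms general_position_affine_hull finite_subset unfolding Ts_def by blast+
    then show "\<exists>e>0. \<forall>a b. e * norm a \<le> (\<Sum>i\<in>T. \<bar>a \<bullet> c i + b\<bar>)"
      by (rule affine_hull_UNIV_far_from_hyperplanes) blast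
  qed
  obtain e where
    e: "\<forall>T\<in>Ts. e T > 0 \<and> (\<forall>a b. e T * norm a \<le> (\<Sum>i\<in>T. \<bar>a \<bullet> c i + b\<bar>))"
    using bchoice[OF far] by blast
  define r where "r = Min (insert 1 ((\<lambda>T. e T / (DIM('a) + 1)) ` Ts))"
  show ?thesis
  proof (rule that)
    show "r > 0" unfolding r_def using \<open>finite Ts\<close> e by (simp add: Min_gr_iff)
  next
    fix a b
    define Near where "Near = {i\<in>I. \<bar>a \<bullet> c i + b\<bar> < r * norm a}"
    show "card Near \<le> DIM('a)"
    proof (rule ccontr)
      assume "\<not> card Near \<le> DIM('a)"
      then obtain T where "T \<subseteq> Near" "card T = DIM('a) + 1"
        by (metis not_less_eq_eq obtain_subset_with_card_n Suc_eq_plus1)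
      then have T: "T \<in> Ts" "finite T" "T \<noteq> {}"
        unfolding Ts_def Near_def by (auto intro: card_ge_0_finite)
      have "r \<le> e T / (DIM('a) + 1)" unfolding r_def using \<open>finite Ts\<close> T by simp
      then have "(DIM('a) + 1) * r \<le> e T" by (simp add: field_simps)
      then have "(DIM('a) + 1) * (r * norm a) \<le> e T * norm a"
        by (metis mult.assoc mult_right_mono norm_ge_zero)
      also have "\<dots> \<le> (\<Sum>i\<in>T. \<bar>a \<bullet> c i + b\<bar>)" using e T(1) by blast
      also have "\<dots> < (\<Sum>i\<in>T. r * norm a)"
        using \<open>T \<subseteq> Near\<close> T by (intro sum_strict_mono) (auto simp: Near_def)
      finally show False using \<open>card T = DIM('a) + 1\<close> by simp
    qed
  qed
qed

theorem mainTheorem9: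
  fixes n :: nat
  assumes "n > 0"
  shows "\<exists>\<mu> :: nat \<Rightarrow> 'a::euclidean_space measure.
           (\<forall>i < n * DIM('a) + 1. mass_distribution (\<mu> i)) \<and>
           (\<forall>L. length L = n \<longrightarrow> (\<forall>h \<in> set L. oriented_hyperplane h) \<longrightarrow>
                \<not> simul_bisects L \<mu> {..< n * DIM('a) + 1})"
proof -
  define N where "N = n * DIM('a) + 1"
  obtain c :: "nat \<Rightarrow> 'a" where c: "general_position c {..<N}"
    using general_position_exists[OF finite_lessThan] by blast
  obtain r where "r > 0"
    and few: "\<And>a b. card {i\<in>{..<N}. \<bar>a \<bullet> c i + b\<bar> < r * norm a} \<le> DIM('a)"
    using general_position_few_points_near_hyperplane[OF finite_lessThan c] by blast
  define \<mu> where "\<mu> i = density lborel (indicator (ball (c i) r))" for i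
  \<comment> \<open>Empty for a hyperplane at infinity (fst h = 0), which therefore needs no separate case.\<close>
  define near where "near h = {i\<in>{..<N}. \<bar>fst h \<bullet> c i + snd h\<bar> < r * norm (fst h)}"
    for h :: "'a \<times> real"
  have "\<not> simul_bisects L \<mu> {..<N}" if "length L = n" for L
  proof
    assume bisects: "simul_bisects L \<mu> {..<N}"
    have "{..<N} \<subseteq> (\<Union>h\<in>set L. near h)"
    proof
      fix i assume "i \<in> {..<N}"
      then obtain h x y where "h \<in> set L" "x \<in> ball (c i) r" "y \<in> ball (c i) r"
        "x \<in> pos_side h" "y \<notin> pos_side h"
        using bisects bisected_ball_is_cut[OF \<open>r > 0\<close>]
        unfolding simul_bisects_def \<mu>_def by meson
      then show "i \<in> (\<Union>h\<in>set L. near h)"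
        using hyperplane_cutting_ball_near_center \<open>i \<in> {..<N}\<close> unfolding near_def by blast
    qed
    then have "N \<le> card (\<Union>h\<in>set L. near h)"
      using card_mono[of "\<Union>h\<in>set L. near h" "{..<N}"] by (simp add: near_def)
    also have "\<dots> \<le> (\<Sum>h\<in>set L. card (near h))"
      by (rule card_UN_le) simp
    also have "\<dots> \<le> card (set L) * DIM('a)"
      using sum_bounded_above[of "set L" "\<lambda>h. card (near h)" "DIM('a)"] few
      unfolding near_def by simp
    also have "\<dots> \<le> n * DIM('a)"
      using card_length[of L] \<open>length L = n\<close> by simp
    finally show False unfolding N_def by simp
  qed
  moreover have "mass_distribution (\<mu> i)" for i
    unfolding \<mu>_def by (rule mass_distribution_ball[OF \<open>r > 0\<close>])
  ultimately show ?thesis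
    unfolding N_def by blast
qed

end
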